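(* The map $\dagger:\mathfrak{sl}_3(\mathbb C)\to\mathfrak{sl}_3(\mathbb C)$, $\beta^\dagger=\tilde W\beta^t\tilde W^{-1}$ (where $\beta^t$ is the transpose of $\beta$), is an antiautomorphism of $\mathfrak{sl}_3(\mathbb C)$ satisfying $(\beta^\dagger)^\dagger=\beta$ for all $\beta\in\mathfrak{sl}_3(\mathbb C)$, and $\dagger$ fixes each element of $H$ and each element of $\tilde H$.
   Context: An antiautomorphism of $\mathfrak{sl}_3(\mathbb C)$ is a $\mathbb C$-linear bijection $\theta:\mathfrak{sl}_3(\mathbb C)\to\mathfrak{sl}_3(\mathbb C)$ with $[\beta,\gamma]^\theta=-[\beta^\theta,\gamma^\theta]$ for all $\beta,\gamma$. Let $p_1,p_2,p_3,p_4\in\mathbb C$ be such that all of $p_1,\ p_2,\ p_3,\ p_4,\ p_1+p_2,\ p_1+p_3,\ p_2+p_4,\ p_3+p_4,\ p_1+p_2+p_3+p_4,\ p_1p_4-p_2p_3$ are nonzero. Put $S=p_1+p_2+p_3+p_4$ and $$\mathbf t=\tfrac{(p_1+p_2)(p_1+p_3)}{p_1S},\quad \mathbf u=\tfrac{(p_1+p_3)(p_3+p_4)}{p_3S},\quad \mathbf v=\tfrac{(p_1+p_2)(p_2+p_4)}{p_2S},\quad \mathbf w=\tfrac{(p_2+p_4)(p_3+p_4)}{p_4S},$$ $\nu=\frac{(p_1+p_2)(p_1+p_3)(p_2+p_4)(p_3+p_4)}{(p_1p_4-p_2p_3)^2}$, $\tilde\eta_0=\nu^{-1}$, $\tilde\eta_1=\frac{p_1p_3S}{(p_1+p_2)(p_1+p_3)(p_3+p_4)}$,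 $\tilde\eta_2=\frac{p_2p_4S}{(p_1+p_2)(p_2+p_4)(p_3+p_4)}$, $\tilde\vartheta=\frac{(p_1+p_2)(p_3+p_4)}{p_2p_3-p_1p_4}$, $$U=\begin{pmatrix}1&1&1\\1&1-\mathbf t&1-\mathbf v\\1&1-\mathbf u&1-\mathbf w\end{pmatrix},\qquad \tilde W=\mathrm{diag}(\tilde\eta_0,\tilde\eta_1,\tilde\eta_2),\qquad R=\tilde\vartheta\,\tilde W\,U^{t}$$ ($R$ is invertible). Let $H$ be the Cartan subalgebra of diagonal matrices in $\mathfrak{sl}_3(\mathbb C)$ and let $\tilde H=RHR^{-1}$. *)

theory Defs
  imports "HOL-Analysis.Analysis"
begin

type_synonym cmat3 = "complex^3^3"

definition sl3 :: "cmat3 set" where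
  "sl3 = {A. trace A = 0}"

definition lie_bracket :: "cmat3 \<Rightarrow> cmat3 \<Rightarrow> cmat3" where
  "lie_bracket A B = A ** B - B ** A"

text \<open>Linearity is over the complex numbers; the library constant \<open>linear\<close> on this type
  would only mean real linearity. Scalar multiples are \<open>map_matrix ((*) c) A\<close>.\<close>
definition sl3_antiautomorphism :: "(cmat3 \<Rightarrow> cmat3) \<Rightarrow> bool" where
  "sl3_antiautomorphism \<theta> \<longleftrightarrow>
     bij_betw \<theta> sl3 sl3 \<and>
     (\<forall>A\<in>sl3. \<forall>B\<in>sl3. \<theta> (A + B) = \<theta> A + \<theta> B) \<and>
     (\<forall>c. \<forall>A\<in>sl3. \<theta> (map_matrix ((*) c) A) = map_matrix ((*) c) (\<theta> A)) \<and>
     (\<forall>A\<in>sl3. \<forall>B\<in>sl3. \<theta> (lie_bracket A B) = - lie_bracket (\<theta> A) (\<theta> B))"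

definition diag3 :: "complex \<Rightarrow> complex \<Rightarrow> complex \<Rightarrow> cmat3" where
  "diag3 a b c = vector [vector [a, 0, 0], vector [0, b, 0], vector [0, 0, c]]"

definition cartan_H :: "cmat3 set" where
  "cartan_H = {A \<in> sl3. \<forall>i j. i \<noteq> j \<longrightarrow> A $ i $ j = 0}"

definition t_par :: "complex \<Rightarrow> complex \<Rightarrow> complex \<Rightarrow> complex \<Rightarrow> complex" where
  "t_par p1 p2 p3 p4 = (p1 + p2) * (p1 + p3) / (p1 * (p1 + p2 + p3 + p4))"

definition u_par :: "complex \<Rightarrow> complex \<Rightarrow> complex \<Rightarrow> complex \<Rightarrow> complex" where
  "u_par p1 p2 p3 p4 = (p1 + p3) * (p3 + p4) / (p3 * (p1 + p2 + p3 + p4))"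

definition v_par :: "complex \<Rightarrow> complex \<Rightarrow> complex \<Rightarrow> complex \<Rightarrow> complex" where
  "v_par p1 p2 p3 p4 = (p1 + p2) * (p2 + p4) / (p2 * (p1 + p2 + p3 + p4))"

definition w_par :: "complex \<Rightarrow> complex \<Rightarrow> complex \<Rightarrow> complex \<Rightarrow> complex" where
  "w_par p1 p2 p3 p4 = (p2 + p4) * (p3 + p4) / (p4 * (p1 + p2 + p3 + p4))"

definition nu_par :: "complex \<Rightarrow> complex \<Rightarrow> complex \<Rightarrow> complex \<Rightarrow> complex" where
  "nu_par p1 p2 p3 p4 =
     (p1 + p2) * (p1 + p3) * (p2 + p4) * (p3 + p4) / (p1 * p4 - p2 * p3)\<^sup>2"

definition eta0_tilde :: "complex \<Rightarrow> complex \<Rightarrow> complex \<Rightarrow> complex \<Rightarrow> complex" where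
  "eta0_tilde p1 p2 p3 p4 = inverse (nu_par p1 p2 p3 p4)"

definition eta1_tilde :: "complex \<Rightarrow> complex \<Rightarrow> complex \<Rightarrow> complex \<Rightarrow> complex" where
  "eta1_tilde p1 p2 p3 p4 =
     p1 * p3 * (p1 + p2 + p3 + p4) / ((p1 + p2) * (p1 + p3) * (p3 + p4))"

definition eta2_tilde :: "complex \<Rightarrow> complex \<Rightarrow> complex \<Rightarrow> complex \<Rightarrow> complex" where
  "eta2_tilde p1 p2 p3 p4 =
     p2 * p4 * (p1 + p2 + p3 + p4) / ((p1 + p2) * (p2 + p4) * (p3 + p4))"

definition theta_tilde :: "complex \<Rightarrow> complex \<Rightarrow> complex \<Rightarrow> complex \<Rightarrow> complex" where
  "theta_tilde p1 p2 p3 p4 = (p1 + p2) * (p3 + p4) / (p2 * p3 - p1 * p4)"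

definition U_mat :: "complex \<Rightarrow> complex \<Rightarrow> complex \<Rightarrow> complex \<Rightarrow> cmat3" where
  "U_mat p1 p2 p3 p4 =
     vector [vector [1, 1, 1],
             vector [1, 1 - t_par p1 p2 p3 p4, 1 - v_par p1 p2 p3 p4],
             vector [1, 1 - u_par p1 p2 p3 p4, 1 - w_par p1 p2 p3 p4]]"

definition W_tilde :: "complex \<Rightarrow> complex \<Rightarrow> complex \<Rightarrow> complex \<Rightarrow> cmat3" where
  "W_tilde p1 p2 p3 p4 =
     diag3 (eta0_tilde p1 p2 p3 p4) (eta1_tilde p1 p2 p3 p4) (eta2_tilde p1 p2 p3 p4)"

definition R_mat :: "complex \<Rightarrow> complex \<Rightarrow> complex \<Rightarrow> complex \<Rightarrow> cmat3" where
  "R_mat p1 p2 p3 p4 =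
     map_matrix ((*) (theta_tilde p1 p2 p3 p4))
       (W_tilde p1 p2 p3 p4 ** transpose (U_mat p1 p2 p3 p4))"

definition H_tilde :: "complex \<Rightarrow> complex \<Rightarrow> complex \<Rightarrow> complex \<Rightarrow> cmat3 set" where
  "H_tilde p1 p2 p3 p4 =
     (\<lambda>h. R_mat p1 p2 p3 p4 ** h ** matrix_inv (R_mat p1 p2 p3 p4)) ` cartan_H"

definition dagger :: "complex \<Rightarrow> complex \<Rightarrow> complex \<Rightarrow> complex \<Rightarrow> cmat3 \<Rightarrow> cmat3" where
  "dagger p1 p2 p3 p4 \<beta> =
     W_tilde p1 p2 p3 p4 ** transpose \<beta> ** matrix_inv (W_tilde p1 p2 p3 p4)"

definition admissible :: "complex \<Rightarrow> complex \<Rightarrow> complex \<Rightarrow> complex \<Rightarrow> bool" where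
  "admissible p1 p2 p3 p4 \<longleftrightarrow>
     p1 \<noteq> 0 \<and> p2 \<noteq> 0 \<and> p3 \<noteq> 0 \<and> p4 \<noteq> 0 \<and>
     p1 + p2 \<noteq> 0 \<and> p1 + p3 \<noteq> 0 \<and> p2 + p4 \<noteq> 0 \<and> p3 + p4 \<noteq> 0 \<and>
     p1 + p2 + p3 + p4 \<noteq> 0 \<and> p1 * p4 - p2 * p3 \<noteq> 0"

text \<open>The next two facts ensure that \<open>matrix_inv\<close>, which is unspecified on singular
  matrices, is the genuine inverse wherever it is used above.\<close>

lemma invertible_W_tilde:
  assumes "admissible p1 p2 p3 p4"
  shows "invertible (W_tilde p1 p2 p3 p4)"
  using assms
  by (simp add: invertible_det_nz det_3 W_tilde_def diag3_def admissible_def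
      eta0_tilde_def eta1_tilde_def eta2_tilde_def nu_par_def)

lemma det_U_mat:
  assumes "admissible p1 p2 p3 p4"
  shows "det (U_mat p1 p2 p3 p4) \<noteq> 0"
proof -
  let ?S = "p1 + p2 + p3 + p4"
  let ?N = "(p1 + p2) * (p1 + p3) * (p2 + p4) * (p3 + p4)"
  have nz: "p1 \<noteq> 0" "p2 \<noteq> 0" "p3 \<noteq> 0" "p4 \<noteq> 0" "?S \<noteq> 0" "?N \<noteq> 0" "p1 * p4 - p2 * p3 \<noteq> 0"
    using assms by (auto simp: admissible_def)
  have "det (U_mat p1 p2 p3 p4) =
      t_par p1 p2 p3 p4 * w_par p1 p2 p3 p4 - u_par p1 p2 p3 p4 * v_par p1 p2 p3 p4"
    by (simp add: det_3 U_mat_def algebra_simps)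
  also have "t_par p1 p2 p3 p4 * w_par p1 p2 p3 p4 = ?N / (p1 * p4 * ?S\<^sup>2)"
    by (simp add: t_par_def w_par_def power2_eq_square mult_ac)
  also have "u_par p1 p2 p3 p4 * v_par p1 p2 p3 p4 = ?N / (p2 * p3 * ?S\<^sup>2)"
    by (simp add: u_par_def v_par_def power2_eq_square mult_ac)
  finally have *: "det (U_mat p1 p2 p3 p4) = ?N / (p1 * p4 * ?S\<^sup>2) - ?N / (p2 * p3 * ?S\<^sup>2)" .
  show ?thesis
  proof
    assume "det (U_mat p1 p2 p3 p4) = 0"
    then have "?N / (p1 * p4 * ?S\<^sup>2) = ?N / (p2 * p3 * ?S\<^sup>2)" using * by simp
    then have "?N * (p2 * p3 * ?S\<^sup>2) = ?N * (p1 * p4 * ?S\<^sup>2)"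
      using nz by (subst (asm) frac_eq_eq) (simp_all del: mult_cancel_left mult_cancel_right)
    then have "p2 * p3 * ?S\<^sup>2 = p1 * p4 * ?S\<^sup>2"
      using nz(6) by (metis mult_cancel_left)
    then show False using nz(5,7) by simp
  qed
qed

lemma invertible_R_mat:
  assumes "admissible p1 p2 p3 p4"
  shows "invertible (R_mat p1 p2 p3 p4)"
proof -
  have smult: "map_matrix ((*) c) A = mat c ** A" for c and A :: cmat3
    by (simp add: vec_eq_iff matrix_matrix_mult_def mat_def sum_3 forall_3)
  have "det (mat (theta_tilde p1 p2 p3 p4) :: cmat3) \<noteq> 0"
    using assms by (auto simp: det_3 mat_def theta_tilde_def admissible_def)
  then show ?thesis
    using invertible_W_tilde[OF assms] det_U_mat[OF assms]
    by (simp add: invertible_det_nz R_mat_def smult det_mul)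
qed

end

(* The map dagger is the adjoint for the symmetric bilinear form with Gram matrix
   W^-1.  It fixes R h R^-1 as soon as R^t W^-1 R commutes with h; since
   R = theta W U^t, this matrix is theta^2 U W U^t, and U W U^t is diagonal: the rows of U are
   orthogonal for the weights eta.  With q = p1 p4 - p2 p3, the orthogonality becomes transparent
   from 1 - t = q/(p1 S), 1 - u = -q/(p3 S), 1 - v = -q/(p2 S), 1 - w = q/(p4 S). *)
theory Submission
  imports Defs
begin

lemma matrix_inv_inverts:
  fixes A :: "'a::field^'n^'n"
  assumes "invertible A"
  shows "A ** matrix_inv A = mat 1" "matrix_inv A ** A = mat 1"
  using someI_ex[OF assms[unfolded invertible_def]] by (simp_all add: matrix_inv_def)

lemma matrix_mul_cancel_inv_left:
  fixes A :: "'a::field^'n^'n"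
  assumes "invertible A"
  shows "A ** (matrix_inv A ** X) = X" "matrix_inv A ** (A ** X) = X"
  using matrix_inv_inverts[OF assms] by (simp_all add: matrix_mul_assoc)

lemma trace_transpose: "trace (transpose A) = trace A"
  by (simp add: trace_def transpose_def)

lemma transpose_add: "transpose (A + B) = transpose A + transpose B"
  by (simp add: vec_eq_iff transpose_def)

lemma transpose_diff:
  fixes A B :: "'a::ab_group_add^'n^'m"
  shows "transpose (A - B) = transpose A - transpose B"
  by (simp add: vec_eq_iff transpose_def)

lemma transpose_map_matrix: "transpose (map_matrix f A) = map_matrix f (transpose A)"
  by (simp add: vec_eq_iff transpose_def)

lemma map_matrix_mult_left:
  fixes A B :: "'a::comm_semiring_1^'n^'n"
  shows "map_matrix ((*) c) A ** B = map_matrix ((*) c) (A ** B)"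
  by (simp add: vec_eq_iff matrix_matrix_mult_def sum_distrib_left mult_ac)

lemma map_matrix_mult_right:
  fixes A B :: "'a::comm_semiring_1^'n^'n"
  shows "A ** map_matrix ((*) c) B = map_matrix ((*) c) (A ** B)"
  by (simp add: vec_eq_iff matrix_matrix_mult_def sum_distrib_left mult_ac)

lemma matrix_add_rdistrib:
  fixes A B C :: "'a::comm_ring_1^'n^'n"
  shows "(B + C) ** A = B ** A + C ** A"
  by (simp add: vec_eq_iff matrix_matrix_mult_def distrib_right sum.distrib)

lemma matrix_diff_ldistrib:
  fixes A B C :: "'a::comm_ring_1^'n^'n"
  shows "A ** (B - C) = A ** B - A ** C"
  by (simp add: vec_eq_iff matrix_matrix_mult_def right_diff_distrib sum_subtractf)

lemma matrix_diff_rdistrib: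
  fixes A B C :: "'a::comm_ring_1^'n^'n"
  shows "(B - C) ** A = B ** A - C ** A"
  by (simp add: vec_eq_iff matrix_matrix_mult_def left_diff_distrib sum_subtractf)

lemma transpose_off_diag_zero:
  assumes "\<forall>i j. i \<noteq> j \<longrightarrow> A $ i $ j = 0"
  shows "transpose A = A"
  unfolding vec_eq_iff transpose_def vec_lambda_beta using assms by metis

lemma off_diag_zero_commute:
  fixes A B :: "'a::comm_semiring_1^'n^'n"
  assumes A: "\<forall>i j. i \<noteq> j \<longrightarrow> A $ i $ j = 0" and B: "\<forall>i j. i \<noteq> j \<longrightarrow> B $ i $ j = 0"
  shows "A ** B = B ** A"
proof -
  \<comment> \<open>The two sums over k agree term by term: both sides vanish unless i = k = j, and
    there scalars commute.\<close>
  have "A $ i $ k * B $ k $ j = B $ i $ k * A $ k $ j" for i j k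
    by (cases "i = k"; cases "k = j") (auto simp: A B mult.commute)
  then show ?thesis by (simp add: vec_eq_iff matrix_matrix_mult_def)
qed

text \<open>As h is symmetric, R h R^-1 has transpose R^-t h R^t. Inserting R R^-1 on the right puts
  the Gram matrix D = R^t W^-1 R next to h. Once \<open>comm\<close> has moved D to the left of h,
  its factor R^t cancels R^-t, and W then meets W^-1.\<close>

lemma transpose_twisted_conj_fixed:
  fixes W R h :: "'a::field^'n^'n"
  assumes W: "invertible W" and R: "invertible R" and h: "transpose h = h"
    and comm: "(transpose R ** matrix_inv W ** R) ** h = h ** (transpose R ** matrix_inv W ** R)"
  shows "W ** transpose (R ** h ** matrix_inv R) ** matrix_inv W = R ** h ** matrix_inv R"
proof -
  let ?T = "transpose (matrix_inv R)" and ?D = "transpose R ** matrix_inv W ** R"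
  have TR: "?T ** transpose R = mat 1"
    by (metis matrix_inv_inverts(1)[OF R] matrix_transpose_mul transpose_mat)
  have "W ** transpose (R ** h ** matrix_inv R) ** matrix_inv W
      = W ** ?T ** (h ** ?D) ** matrix_inv R"
    by (simp add: matrix_transpose_mul h matrix_inv_inverts[OF R] flip: matrix_mul_assoc)
  also have "\<dots> = W ** (?T ** transpose R) ** matrix_inv W ** R ** h ** matrix_inv R"
    by (simp add: flip: comm) (simp add: matrix_mul_assoc)
  also have "\<dots> = R ** h ** matrix_inv R"
    by (simp add: TR matrix_inv_inverts[OF W])
  finally show ?thesis .
qed

lemma W_tilde_off_diag: "\<forall>i j. i \<noteq> j \<longrightarrow> W_tilde p1 p2 p3 p4 $ i $ j = 0"
  by (simp add: forall_3 W_tilde_def diag3_def)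

lemma transpose_W_tilde: "transpose (W_tilde p1 p2 p3 p4) = W_tilde p1 p2 p3 p4"
  using W_tilde_off_diag by (rule transpose_off_diag_zero)

lemma dagger_add: "dagger p1 p2 p3 p4 (A + B) = dagger p1 p2 p3 p4 A + dagger p1 p2 p3 p4 B"
  by (simp add: dagger_def transpose_add matrix_add_ldistrib matrix_add_rdistrib)

lemma dagger_diff: "dagger p1 p2 p3 p4 (A - B) = dagger p1 p2 p3 p4 A - dagger p1 p2 p3 p4 B"
  by (simp add: dagger_def transpose_diff matrix_diff_ldistrib matrix_diff_rdistrib)

lemma dagger_scale:
  "dagger p1 p2 p3 p4 (map_matrix ((*) c) A) = map_matrix ((*) c) (dagger p1 p2 p3 p4 A)"
  by (simp only: dagger_def transpose_map_matrix map_matrix_mult_left map_matrix_mult_right)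

context
  fixes p1 p2 p3 p4 :: complex
  assumes adm: "admissible p1 p2 p3 p4"
begin

text \<open>Transposing W W^-1 = 1 shows that W^-t is a left inverse of the symmetric matrix W, and
  such an inverse is unique.\<close>

lemma transpose_matrix_inv_W_tilde:
  "transpose (matrix_inv (W_tilde p1 p2 p3 p4)) = matrix_inv (W_tilde p1 p2 p3 p4)"
proof -
  let ?W = "W_tilde p1 p2 p3 p4"
  note inv = matrix_inv_inverts[OF invertible_W_tilde[OF adm]]
  have "transpose (?W ** matrix_inv ?W) = mat 1" by (simp add: inv transpose_mat)
  then have "transpose (matrix_inv ?W) ** ?W = mat 1"
    by (simp only: matrix_transpose_mul transpose_W_tilde)
  then have "transpose (matrix_inv ?W) ** ?W ** matrix_inv ?W = matrix_inv ?W" by simp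
  then show ?thesis by (simp add: inv flip: matrix_mul_assoc)
qed

lemma dagger_mult:
  "dagger p1 p2 p3 p4 (A ** B) = dagger p1 p2 p3 p4 B ** dagger p1 p2 p3 p4 A"
  by (simp add: dagger_def matrix_transpose_mul
      matrix_mul_cancel_inv_left[OF invertible_W_tilde[OF adm]] flip: matrix_mul_assoc)

text \<open>Applying the map twice conjugates by W W^-t, which is the identity because W is
  symmetric.\<close>

lemma dagger_dagger: "dagger p1 p2 p3 p4 (dagger p1 p2 p3 p4 A) = A"
  by (simp add: dagger_def matrix_transpose_mul transpose_matrix_inv_W_tilde transpose_W_tilde
      matrix_mul_cancel_inv_left[OF invertible_W_tilde[OF adm]]
      matrix_inv_inverts[OF invertible_W_tilde[OF adm]] flip: matrix_mul_assoc)

lemma dagger_in_sl3: "A \<in> sl3 \<Longrightarrow> dagger p1 p2 p3 p4 A \<in> sl3"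
  unfolding sl3_def dagger_def mem_Collect_eq
  \<comment> \<open>Cyclicity of the trace brings W^-1 in front of W, leaving the trace of the
    transpose.\<close>
  by (subst trace_mul_sym)
     (simp add: matrix_mul_cancel_inv_left[OF invertible_W_tilde[OF adm]] trace_transpose)

text \<open>Reversing products exchanges the two terms of a commutator, which is the source of the
  minus sign. Being an involution of \<open>sl3\<close>, the map is its own inverse there.\<close>

lemma sl3_antiautomorphism_dagger: "sl3_antiautomorphism (dagger p1 p2 p3 p4)"
proof -
  have "bij_betw (dagger p1 p2 p3 p4) sl3 sl3"
    by (rule bij_betw_byWitness[where f' = "dagger p1 p2 p3 p4"])
       (auto simp: dagger_dagger dagger_in_sl3)
  then show ?thesis
    by (simp add: sl3_antiautomorphism_def dagger_add dagger_scale lie_bracket_def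
        dagger_diff dagger_mult)
qed

text \<open>A diagonal h is symmetric, and conjugation by the diagonal W does not move it.\<close>

lemma dagger_cartan_H:
  assumes "h \<in> cartan_H"
  shows "dagger p1 p2 p3 p4 h = h"
proof -
  have h: "\<forall>i j. i \<noteq> j \<longrightarrow> h $ i $ j = 0" using assms by (auto simp: cartan_H_def)
  have "W_tilde p1 p2 p3 p4 ** h = h ** W_tilde p1 p2 p3 p4"
    using W_tilde_off_diag h by (rule off_diag_zero_commute)
  then show ?thesis
    by (simp add: dagger_def transpose_off_diag_zero[OF h])
       (simp add: matrix_inv_inverts[OF invertible_W_tilde[OF adm]] flip: matrix_mul_assoc)
qed

text \<open>The entries rest on p1 S - (p1 + p2)(p1 + p3) = q and its three analogues; those for p2
  and p3 give -q.\<close>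

lemma U_mat_eq:
  fixes q S
  defines "q \<equiv> p1 * p4 - p2 * p3" and "S \<equiv> p1 + p2 + p3 + p4"
  shows "U_mat p1 p2 p3 p4 = vector [vector [1, 1, 1],
           vector [1, q / (p1 * S), - q / (p2 * S)],
           vector [1, - q / (p3 * S), q / (p4 * S)]]"
proof -
  have nz: "p1 \<noteq> 0" "p2 \<noteq> 0" "p3 \<noteq> 0" "p4 \<noteq> 0" "S \<noteq> 0"
    using adm by (auto simp: admissible_def S_def)
  have "1 - t_par p1 p2 p3 p4 = q / (p1 * S)" "1 - u_par p1 p2 p3 p4 = - q / (p3 * S)"
    "1 - v_par p1 p2 p3 p4 = - q / (p2 * S)" "1 - w_par p1 p2 p3 p4 = q / (p4 * S)"
    using nz unfolding t_par_def u_par_def v_par_def w_par_def S_def[symmetric]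
    by (simp_all add: divide_simps) (simp_all add: S_def q_def algebra_simps)
  then show ?thesis by (simp add: U_mat_def)
qed

lemma U_mat_rows_orthogonal:
  assumes "i \<noteq> j"
  shows "(U_mat p1 p2 p3 p4 ** W_tilde p1 p2 p3 p4 ** transpose (U_mat p1 p2 p3 p4)) $ i $ j = 0"
proof -
  define q S a b c d where defs: "q = p1 * p4 - p2 * p3" "S = p1 + p2 + p3 + p4"
    "a = p1 + p2" "b = p1 + p3" "c = p2 + p4" "d = p3 + p4"
  have nz: "p1 \<noteq> 0" "p2 \<noteq> 0" "p3 \<noteq> 0" "p4 \<noteq> 0" "S \<noteq> 0" "q \<noteq> 0" "a \<noteq> 0" "b \<noteq> 0" "c \<noteq> 0" "d \<noteq> 0"
    using adm by (auto simp: admissible_def defs)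
  have eta: "eta0_tilde p1 p2 p3 p4 = q\<^sup>2 / (a * b * c * d)"
    "eta1_tilde p1 p2 p3 p4 = p1 * p3 * S / (a * b * d)"
    "eta2_tilde p1 p2 p3 p4 = p2 * p4 * S / (a * c * d)"
    by (simp_all add: eta0_tilde_def eta1_tilde_def eta2_tilde_def nu_par_def defs)
  \<comment> \<open>The product of rows 1 and 2 weighted by the eta. Here and below a, b, c, d, q, S
    act as independent symbols while denominators are cleared; their relations enter only through
    the remaining factor, here q = p4 b - p3 c.\<close>
  have "q\<^sup>2 / (a * b * c * d) + p3 * q / (a * b * d) - p4 * q / (a * c * d)
      = q * (q + p3 * c - p4 * b) / (a * b * c * d)"
    using nz by (simp add: divide_simps) (simp add: power2_eq_square algebra_simps)
  also have "q + p3 * c - p4 * b = 0" by (simp add: defs algebra_simps)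
  finally have 12: "q\<^sup>2 / (a * b * c * d) + p3 * q / (a * b * d) - p4 * q / (a * c * d) = 0"
    by simp
  \<comment> \<open>Rows 1 and 3, which vanish by q = p1 c - p2 b.\<close>
  have "q\<^sup>2 / (a * b * c * d) - p1 * q / (a * b * d) + p2 * q / (a * c * d)
      = q * (q - p1 * c + p2 * b) / (a * b * c * d)"
    using nz by (simp add: divide_simps) (simp add: power2_eq_square algebra_simps)
  also have "q - p1 * c + p2 * b = 0" by (simp add: defs algebra_simps)
  finally have 13: "q\<^sup>2 / (a * b * c * d) - p1 * q / (a * b * d) + p2 * q / (a * c * d) = 0"
    by simp
  \<comment> \<open>Rows 2 and 3, which vanish by S = b + c.\<close>
  have "q\<^sup>2 / (a * b * c * d) - q\<^sup>2 / (a * b * d * S) - q\<^sup>2 / (a * c * d * S)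
      = q\<^sup>2 * (S - c - b) / (a * b * c * d * S)"
    using nz by (simp add: divide_simps) (simp add: algebra_simps)
  also have "S - c - b = 0" by (simp add: defs)
  finally have 23: "q\<^sup>2 / (a * b * c * d) - q\<^sup>2 / (a * b * d * S) - q\<^sup>2 / (a * c * d * S) = 0"
    by simp
  show ?thesis
    \<comment> \<open>U W U^t is symmetric, so the three sums cover all six off-diagonal
      positions.\<close>
    unfolding U_mat_eq W_tilde_def diag3_def eta defs(1,2)[symmetric]
    using assms exhaust_3[of i] exhaust_3[of j] nz 12 13 23
    by (auto simp: matrix_matrix_mult_def transpose_def sum_3 power2_eq_square mult_ac)
qed

text \<open>Since W is symmetric, R^t = theta U W, and the middle of U W W^-1 W U^t collapses to a
  single W.\<close>

lemma R_mat_gram: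
  "transpose (R_mat p1 p2 p3 p4) ** matrix_inv (W_tilde p1 p2 p3 p4) ** R_mat p1 p2 p3 p4 =
   map_matrix ((*) ((theta_tilde p1 p2 p3 p4)\<^sup>2))
     (U_mat p1 p2 p3 p4 ** W_tilde p1 p2 p3 p4 ** transpose (U_mat p1 p2 p3 p4))"
proof -
  have *: "map_matrix ((*) c) (map_matrix ((*) c) A) = map_matrix ((*) (c\<^sup>2)) A" for c and A :: cmat3
    by (simp add: vec_eq_iff power2_eq_square)
  show ?thesis
    unfolding R_mat_def transpose_map_matrix map_matrix_mult_left map_matrix_mult_right *
    by (simp add: matrix_transpose_mul transpose_W_tilde
        matrix_mul_cancel_inv_left[OF invertible_W_tilde[OF adm]] flip: matrix_mul_assoc)
qed

lemma dagger_H_tilde: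
  assumes "g \<in> H_tilde p1 p2 p3 p4"
  shows "dagger p1 p2 p3 p4 g = g"
proof -
  obtain h where g: "g = R_mat p1 p2 p3 p4 ** h ** matrix_inv (R_mat p1 p2 p3 p4)"
    and "h \<in> cartan_H" using assms by (auto simp: H_tilde_def)
  then have h: "\<forall>i j. i \<noteq> j \<longrightarrow> h $ i $ j = 0" by (auto simp: cartan_H_def)
  show ?thesis
    unfolding dagger_def g
    \<comment> \<open>The commutation hypothesis holds because the Gram matrix and h are both
      diagonal.\<close>
    by (rule transpose_twisted_conj_fixed[OF invertible_W_tilde[OF adm] invertible_R_mat[OF adm]
            transpose_off_diag_zero[OF h]], unfold R_mat_gram,
        rule off_diag_zero_commute) (simp_all add: U_mat_rows_orthogonal h)
qed

end

theorem mainTheorem6: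
  fixes p1 p2 p3 p4 :: complex
  assumes "admissible p1 p2 p3 p4"
  shows "sl3_antiautomorphism (dagger p1 p2 p3 p4) \<and>
         (\<forall>\<beta>\<in>sl3. dagger p1 p2 p3 p4 (dagger p1 p2 p3 p4 \<beta>) = \<beta>) \<and>
         (\<forall>h\<in>cartan_H. dagger p1 p2 p3 p4 h = h) \<and>
         (\<forall>h\<in>H_tilde p1 p2 p3 p4. dagger p1 p2 p3 p4 h = h)"
  using sl3_antiautomorphism_dagger[OF assms] dagger_dagger[OF assms] dagger_cartan_H[OF assms]
    dagger_H_tilde[OF assms] by blast

end
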